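(* Let $n\ge2$, let $\mathcal H(s_1,\dots,s_n)$ be a rational function, and let $\mathbb L_n$ be the $n$-D Loewner matrix built from the evaluations of $\mathcal H$ at the column points $\lambda^{(l)}_j$ ($1\le j\le k_l$) and row points $\mu^{(l)}_i$ ($1\le i\le q_l$), $1\le l\le n$. Then the variables decouple: with the vectors $c^{s_l}\in\mathbb C^{k_1k_2\cdots k_l}$ ($1\le l\le n$) of single-variable barycentric coefficients defined in the context, the null space of $\mathbb L_n$ is spanned by $$c_n=c^{s_n}\odot\big(c^{s_{n-1}}\otimes\mathbf 1_{k_n}\big)\odot\big(c^{s_{n-2}}\otimes\mathbf 1_{k_nk_{n-1}}\big)\odot\cdots\odot\big(c^{s_1}\otimes\mathbf 1_{k_n\cdots k_2}\big),$$ where $\odot$ is the entrywise product, $\otimes$ the Kronecker product and $\mathbf 1_p$ the all-ones column vector of length $p$.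
   Context: Data: for each $l$, the column points $\lambda^{(l)}_1,\dots,\lambda^{(l)}_{k_l}$ and row points $\mu^{(l)}_1,\dots,\mu^{(l)}_{q_l}$ are pairwise distinct complex numbers, and $\mathcal H$ is evaluated at every point whose $l$-th coordinate is one of these (for each $l$), including mixed row/column points (the denominator of $\mathcal H$ is nonzero at all of them). Loewner matrices: given a function $G$ of $p$ variables with column points $\lambda^{(l)}_j$ and row points $\mu^{(l)}_i$ ($1\le l\le p$), its $p$-D Loewner matrix has, in row $(i_1,\dots,i_p)$ and column $(j_1,\dots,j_p)$ (multi-indices ordered lexicographically, last index fastest), the entry $$\frac{G(\mu^{(1)}_{i_1},\dots,\mu^{(p)}_{i_p})-G(\lambda^{(1)}_{j_1},\dots,\lambda^{(p)}_{j_p})}{\prod_{l=1}^p(\mu^{(l)}_{i_l}-\lambda^{(l)}_{j_l})}.$$ A Loewner matrix "for frozen" values of some variables is the Loewner matrix of the function obtained from $\mathcal H$ by fixing those variables, using the column/row points of the remaining variables. Definition of $c^{s_l}$: for each $(j_1,\dots,j_{l-1})$ with $1\le j_r\le k_r$, let $c_1^{(\lambda^{(1)}_{j_1},\dots,\lambda^{(l-1)}_{j_{l-1}},\lambda^{(l+1)}_{k_{l+1}},\dots,\lambda^{(n)}_{k_n})}\in\mathbb C^{k_l}$ span the null space of the 1-D Loewner matrix in the variable $s_l$ for frozen $s_r=\lambda^{(r)}_{j_r}$ ($r<l$) and $s_r=\lambda^{(r)}_{k_r}$ ($r>l$), normalized so that its last entry equals $1$. Then $c^{s_l}$ is the vector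 obtained by stacking these $k_1\cdots k_{l-1}$ vectors, with $(j_1,\dots,j_{l-1})$ in lexicographic order (last index fastest); in particular $c^{s_1}=c_1^{(\lambda^{(2)}_{k_2},\dots,\lambda^{(n)}_{k_n})}$. Standing assumptions: the number of interpolation points is appropriate, i.e. $k_l=d_l+1$, where $d_l$ is the degree of $\mathcal H$ in $s_l$ (the highest power of $s_l$ in numerator and denominator), and $\mathbb L_n$ as well as all frozen Loewner matrices arising when the null space is computed recursively (those with $s_r=\lambda^{(r)}_{j_r}$ for $r<l$ frozen, and the 1-D ones above) have one-dimensional null space. *)

theory Defs
  imports
    "HOL-Library.Poly_Mapping"
    "Jordan_Normal_Form.Matrix_Kernel"
begin

text \<open>
  Variables are numbered from 0: the variable \<open>s\<^sub>l\<close> of the informal text has index \<open>l - 1\<close>, and its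
  column and row points are the lists \<open>lam ! (l - 1)\<close> and \<open>mu ! (l - 1)\<close>. In particular \<open>k\<^sub>l\<close> is
  \<open>length (lam ! (l - 1))\<close>.
\<close>

section \<open>Multivariate rational functions\<close>

text \<open>A polynomial maps each monomial (a finitely supported exponent function) to its coefficient.\<close>

type_synonym cpoly = "(nat \<Rightarrow>\<^sub>0 nat) \<Rightarrow>\<^sub>0 complex"

definition poly_vars :: "cpoly \<Rightarrow> nat set" where
  "poly_vars P = (\<Union>m\<in>Poly_Mapping.keys P. Poly_Mapping.keys m)"

definition poly_deg_in :: "cpoly \<Rightarrow> nat \<Rightarrow> nat" where
  "poly_deg_in P l = Max (insert 0 ((\<lambda>m. Poly_Mapping.lookup m l) ` Poly_Mapping.keys P))"

definition poly_eval :: "cpoly \<Rightarrow> complex list \<Rightarrow> complex" where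
  "poly_eval P xs = (\<Sum>m\<in>Poly_Mapping.keys P. Poly_Mapping.lookup P m *
     (\<Prod>i\<in>Poly_Mapping.keys m. (xs ! i) ^ Poly_Mapping.lookup m i))"

text \<open>
  The constant \<open>coprime\<close> is not available for this type, which is an integral domain without a
  division operation.
\<close>

definition lowest_terms :: "cpoly \<Rightarrow> cpoly \<Rightarrow> bool" where
  "lowest_terms N D \<longleftrightarrow> (\<forall>Q. Q dvd N \<longrightarrow> Q dvd D \<longrightarrow> Q dvd 1)"

definition rat_eval :: "cpoly \<Rightarrow> cpoly \<Rightarrow> complex list \<Rightarrow> complex" where
  "rat_eval N D xs = poly_eval N xs / poly_eval D xs"

text \<open>This is the degree of the rational function \<open>N / D\<close> only if \<open>N / D\<close> is in lowest terms.\<close>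

definition rat_deg_in :: "cpoly \<Rightarrow> cpoly \<Rightarrow> nat \<Rightarrow> nat" where
  "rat_deg_in N D l = max (poly_deg_in N l) (poly_deg_in D l)"

section \<open>Loewner matrices and null spaces\<close>

text \<open>
  \<open>product_lists\<close> enumerates the tuples of points in the lexicographic order of their multi-indices,
  last index fastest.
\<close>

definition loewner_mat ::
  "(complex list \<Rightarrow> complex) \<Rightarrow> complex list list \<Rightarrow> complex list list \<Rightarrow> complex mat" where
  "loewner_mat G mu lam =
     mat (length (product_lists mu)) (length (product_lists lam))
       (\<lambda>(i, j). let xs = product_lists mu ! i; ys = product_lists lam ! j
                 in (G xs - G ys) / prod_list (map2 (-) xs ys))"

definition spans_null_space :: "complex mat \<Rightarrow> complex vec \<Rightarrow> bool" where
  "spans_null_space A v \<longleftrightarrow> v \<in> carrier_vec (dim_col A) \<and>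
     LinearCombinations.module.span class_ring (module_vec TYPE(complex) (dim_col A)) {v}
       = mat_kernel A"

definition normalized_null_vec :: "complex mat \<Rightarrow> complex vec" where
  "normalized_null_vec A = (THE v. spans_null_space A v \<and> v $ (dim_vec v - 1) = 1)"

text \<open>
  The list \<open>pre\<close> holds the frozen values of the variables \<open>0, \<dots>, length pre - 1\<close>. For the
  one-dimensional matrix in the variable \<open>l = length pre\<close>, the later variables are frozen at their
  last column points.
\<close>

definition frozen_loewner ::
  "(complex list \<Rightarrow> complex) \<Rightarrow> complex list list \<Rightarrow> complex list list \<Rightarrow> complex list \<Rightarrow> complex mat" where
  "frozen_loewner H mu lam pre =
     loewner_mat (\<lambda>xs. H (pre @ xs)) (drop (length pre) mu) (drop (length pre) lam)"

definition frozen_loewner_1d ::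
  "(complex list \<Rightarrow> complex) \<Rightarrow> complex list list \<Rightarrow> complex list list \<Rightarrow> complex list \<Rightarrow> complex mat" where
  "frozen_loewner_1d H mu lam pre = (let l = length pre in
     loewner_mat (\<lambda>xs. H (pre @ xs @ map last (drop (Suc l) lam))) [mu ! l] [lam ! l])"

section \<open>Barycentric coefficients\<close>

definition bary_coeffs ::
  "(complex list \<Rightarrow> complex) \<Rightarrow> complex list list \<Rightarrow> complex list list \<Rightarrow> nat \<Rightarrow> complex vec" where
  "bary_coeffs H mu lam l =
     vec_of_list (concat (map (\<lambda>pre. list_of_vec (normalized_null_vec (frozen_loewner_1d H mu lam pre)))
       (product_lists (take l lam))))"

definition hadamard_vec :: "complex vec \<Rightarrow> complex vec \<Rightarrow> complex vec" (infixl \<open>\<odot>\<close> 70) where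
  "u \<odot> v = vec (dim_vec u) (\<lambda>i. u $ i * v $ i)"

definition kronecker_vec :: "complex vec \<Rightarrow> complex vec \<Rightarrow> complex vec" where
  "kronecker_vec u v =
     vec (dim_vec u * dim_vec v) (\<lambda>i. u $ (i div dim_vec v) * v $ (i mod dim_vec v))"

definition ones_vec :: "nat \<Rightarrow> complex vec" where
  "ones_vec m = vec m (\<lambda>_. 1)"

definition decoupled_coeffs ::
  "(complex list \<Rightarrow> complex) \<Rightarrow> complex list list \<Rightarrow> complex list list \<Rightarrow> complex vec" where
  "decoupled_coeffs H mu lam = (let n = length lam in
     foldl (\<odot>) (bary_coeffs H mu lam (n - 1))
       (map (\<lambda>l. kronecker_vec (bary_coeffs H mu lam l)
                    (ones_vec (prod_list (map length (drop (Suc l) lam)))))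
         (rev [0..<n - 1])))"

end

(*  Let w denote the products of the barycentric weights of the column points. Writing H = N / D,
    tensor product Lagrange interpolation of N and D on the column grid shows that the vector of
    all w * D at the column points is a null vector of the Loewner matrix, and since D does not
    vanish there and the null space is one-dimensional, it spans the null space. The same applies
    to each frozen one-dimensional Loewner matrix, so each normalized null vector has the quotients
    of w * D at two grid points as entries; in the decoupled product these quotients telescope. *)

theory Submission
  imports Defs "HOL-Computational_Algebra.Polynomial"
begin

section \<open>Null spaces of dimension one\<close>

lemma span_singleton_vec:
  fixes v :: "complex vec"
  assumes "v \<in> carrier_vec m"
  shows "LinearCombinations.module.span class_ring (module_vec TYPE(complex) m) {v} =
    range (\<lambda>a. a \<cdot>\<^sub>v v)"
proof -
  interpret vec_space "TYPE(complex)" m .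
  have "a \<cdot>\<^sub>v v \<in> span {v}" for a
    using assms by (intro smult_in_span) (auto intro: span_self)
  moreover have "\<exists>a. x = a \<cdot>\<^sub>v v" if "x \<in> span {v}" for x
  proof -
    have "x \<in> span (set [v])" using that by simp
    then obtain c where "x = lincomb_list c [v]"
      using in_span_listE assms by (metis empty_iff insert_iff list.set(1) list.simps(15) span_list_as_span subsetI)
    then have "x = c 0 \<cdot>\<^sub>v v" using assms by (simp add: lincomb_list_def)
    then show ?thesis by blast
  qed
  ultimately show ?thesis by (intro subset_antisym subsetI) (blast, metis rangeE)
qed

text \<open>A basis of the null space is a single vector \<open>b\<close>, and a nonzero null vector
  is a nonzero multiple of \<open>b\<close>, so both have the same multiples.\<close>

lemma spans_null_spaceI:
  assumes dim: "kernel_dim A = 1" and v: "v \<in> mat_kernel A" and nz: "v \<noteq> 0\<^sub>v (dim_col A)"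
  shows "spans_null_space A v"
proof -
  interpret K: kernel "dim_row A" "dim_col A" A by unfold_locales auto
  have carr: "v \<in> carrier_vec (dim_col A)" using v by (auto simp: mat_kernel_def)
  obtain B where fB: "finite B" and B: "K.basis B"
    using kernel_basis_exists[of A "dim_row A" "dim_col A"] by auto
  have cB: "card B = 1" using K.Ker.dim_basis[OF fB B] dim by simp
  then obtain b where Bb: "B = {b}" using card_1_singletonE by blast
  have gen: "K.span {b} = mat_kernel A" and b: "b \<in> mat_kernel A"
    using B unfolding K.Ker.basis_def Bb by auto
  \<comment> \<open>\<open>K.span\<close> is the span inside the null space as a module of its own,
    whereas \<open>spans_null_space\<close> speaks of the span in the ambient space.\<close>
  have "K.NC.span {b} = mat_kernel A" using K.span_same[of "{b}"] b gen by simp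
  moreover have bc: "b \<in> carrier_vec (dim_col A)" using b by (auto simp: mat_kernel_def)
  ultimately have ker: "mat_kernel A = range (\<lambda>a. a \<cdot>\<^sub>v b)" by (simp add: span_singleton_vec)
  then obtain c where c: "v = c \<cdot>\<^sub>v b" using v by auto
  have "c \<noteq> 0" using nz c bc by auto
  have "a \<cdot>\<^sub>v b = (a / c) \<cdot>\<^sub>v v" for a using \<open>c \<noteq> 0\<close> c by (simp add: smult_smult_assoc)
  moreover have "a \<cdot>\<^sub>v v = (a * c) \<cdot>\<^sub>v b" for a using c by (simp add: smult_smult_assoc)
  ultimately have "range (\<lambda>a. a \<cdot>\<^sub>v v) = mat_kernel A" unfolding ker by blast
  then show ?thesis unfolding spans_null_space_def using span_singleton_vec[OF carr] carr by simp
qed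

text \<open>The definite description is meaningful because two vectors spanning the same line are
  proportional, and last entries equal to 1 leave only the factor 1.\<close>

lemma normalized_null_vec_eq:
  assumes dim: "kernel_dim A = 1" and v: "v \<in> mat_kernel A"
    and pos: "0 < dim_vec v" and nz: "v $ (dim_vec v - 1) \<noteq> 0"
  shows "normalized_null_vec A = (1 / v $ (dim_vec v - 1)) \<cdot>\<^sub>v v"
  unfolding normalized_null_vec_def
proof (rule the_equality)
  let ?k = "dim_vec v - 1"
  let ?w = "(1 / v $ ?k) \<cdot>\<^sub>v v"
  have vc: "v \<in> carrier_vec (dim_col A)" using v by (auto simp: mat_kernel_def)
  have k: "?k < dim_vec v" using pos by simp
  have w1: "?w $ ?k = 1" using k nz by simp
  have w: "?w \<in> mat_kernel A" using v mat_kernel_smult[of A "dim_row A" "dim_col A" v] by auto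
  have "?w \<noteq> 0\<^sub>v (dim_col A)"
  proof
    assume "?w = 0\<^sub>v (dim_col A)"
    then have "?w $ ?k = 0" using k vc by (metis carrier_vecD index_zero_vec(1))
    then show False using w1 by simp
  qed
  then have sp: "spans_null_space A ?w" by (rule spans_null_spaceI[OF dim w])
  then show "spans_null_space A ?w \<and> ?w $ (dim_vec ?w - 1) = 1" using w1 by simp
  fix u assume u: "spans_null_space A u \<and> u $ (dim_vec u - 1) = 1"
  then have uc: "u \<in> carrier_vec (dim_col A)" and "range (\<lambda>a. a \<cdot>\<^sub>v u) = mat_kernel A"
    unfolding spans_null_space_def using span_singleton_vec[of u "dim_col A"] by auto
  then obtain a where a: "?w = a \<cdot>\<^sub>v u" using w by blast
  have "dim_vec u = dim_vec v" using uc vc by auto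
  then have "a = 1" using w1 u k unfolding a by simp
  then show "u = ?w" using a by simp
qed

section \<open>Tensor product Lagrange interpolation\<close>

text \<open>For a node \<open>a\<close> of \<open>L\<close> this is the reciprocal of the derivative
  at \<open>a\<close> of the node polynomial, the product of x - b over all nodes b.\<close>

definition bary_weight :: "complex list \<Rightarrow> complex \<Rightarrow> complex" where
  "bary_weight L a = inverse (\<Prod>b\<in>set L - {a}. a - b)"

lemma bary_weight_nonzero: "bary_weight L a \<noteq> 0"
  by (simp add: bary_weight_def)

text \<open>Lagrange interpolation reproduces every polynomial of degree less than the number of
  nodes; division by the value of the node polynomial at \<open>x\<close> gives the barycentric
  form.\<close>

lemma lagrange_barycentric:
  assumes L: "distinct L" and deg: "degree p < length L" and x: "x \<notin> set L"
  shows "(\<Sum>a\<leftarrow>L. bary_weight L a * poly p a / (x - a)) = poly p x / (\<Prod>a\<leftarrow>L. x - a)"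
proof -
  let ?S = "set L"
  \<comment> \<open>The Lagrange interpolant of \<open>p\<close> at the nodes.\<close>
  define q where "q = (\<Sum>a\<in>?S. Polynomial.smult (bary_weight L a * poly p a) (\<Prod>b\<in>?S - {a}. [:- b, 1:]))"
  have "degree (Polynomial.smult (bary_weight L a * poly p a) (\<Prod>b\<in>?S - {a}. [:- b, 1:])) \<le> length L - 1"
    if "a \<in> ?S" for a
  proof -
    have "degree (\<Prod>b\<in>?S - {a}. [:- b, 1:]) \<le> (\<Sum>b\<in>?S - {a}. degree [:- b, 1:])"
      using degree_prod_sum_le[of "?S - {a}" "\<lambda>b. [:- b, 1:]"] by (simp add: o_def)
    also have "\<dots> = length L - 1" using that L by (simp add: distinct_card)
    finally show ?thesis using degree_smult_le le_trans by blast
  qed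
  then have "degree q \<le> length L - 1" unfolding q_def by (intro degree_sum_le) auto
  \<comment> \<open>\<open>deg\<close> forces \<open>L\<close> to be nonempty, so the truncated
    bound \<open>length L - 1\<close> lies strictly below \<open>length L\<close>.\<close>
  then have dq: "degree q < length L" using deg by linarith
  have "poly q c = poly p c" if c: "c \<in> ?S" for c
  proof -
    have "poly q c = (\<Sum>a\<in>?S. bary_weight L a * poly p a * (\<Prod>b\<in>?S - {a}. c - b))"
      by (simp add: q_def poly_sum poly_prod)
    also have "\<dots> = (\<Sum>a\<in>?S. if a = c then poly p c else 0)"
    proof (rule sum.cong[OF refl])
      fix a assume "a \<in> ?S"
      have "(\<Prod>b\<in>?S - {a}. c - b) = 0" if "a \<noteq> c"
        using that c by (intro prod_zero) auto
      moreover have "(\<Prod>b\<in>?S - {c}. c - b) \<noteq> 0" by simp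
      ultimately show "bary_weight L a * poly p a * (\<Prod>b\<in>?S - {a}. c - b) =
          (if a = c then poly p c else 0)"
        by (simp add: bary_weight_def)
    qed
    also have "\<dots> = poly p c" using c by simp
    finally show ?thesis .
  qed
  then have "q = p" using dq deg L by (intro poly_eqI_degree[of ?S]) (auto simp: distinct_card)
  have nz: "(\<Prod>a\<in>?S. x - a) \<noteq> 0" using x by auto
  have "poly p x = (\<Sum>a\<in>?S. bary_weight L a * poly p a * (\<Prod>b\<in>?S - {a}. x - b))"
    by (subst \<open>q = p\<close>[symmetric]) (simp add: q_def poly_sum poly_prod)
  also have "\<dots> = (\<Sum>a\<in>?S. bary_weight L a * poly p a / (x - a)) * (\<Prod>a\<in>?S. x - a)"
    unfolding sum_distrib_right
  proof (rule sum.cong[OF refl])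
    fix a assume a: "a \<in> ?S"
    have "(\<Prod>b\<in>?S. x - b) = (x - a) * (\<Prod>b\<in>?S - {a}. x - b)" using a by (simp add: prod.remove)
    moreover have "x - a \<noteq> 0" using a x by auto
    ultimately show "bary_weight L a * poly p a * (\<Prod>b\<in>?S - {a}. x - b) =
        bary_weight L a * poly p a / (x - a) * (\<Prod>a\<in>?S. x - a)" by simp
  qed
  finally have "(\<Sum>a\<in>?S. bary_weight L a * poly p a / (x - a)) = poly p x / (\<Prod>a\<in>?S. x - a)"
    using nz by (simp add: field_simps)
  then show ?thesis
    using L by (simp add: sum_list_distinct_conv_sum_set prod.distinct_set_conv_list)
qed

text \<open>Only slices along one coordinate have to be polynomials. In this form the property
  survives freezing of variables, and no polynomial in fewer variables has to be
  constructed.\<close>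

definition coordinatewise_poly :: "complex list list \<Rightarrow> (complex list \<Rightarrow> complex) \<Rightarrow> bool" where
  "coordinatewise_poly Ls f \<longleftrightarrow> (\<forall>xs l. length xs = length Ls \<longrightarrow> l < length Ls \<longrightarrow>
     (\<exists>p. degree p < length (Ls ! l) \<and> (\<forall>t. f (xs[l := t]) = poly p t)))"

text \<open>With one leading value frozen this drives the induction over the variables; with values
  frozen before and after a single coordinate it handles the 1-D Loewner matrices.\<close>

lemma coordinatewise_poly_freeze:
  assumes f: "coordinatewise_poly (As @ Bs @ Cs) f"
    and len: "length as = length As" "length cs = length Cs"
  shows "coordinatewise_poly Bs (\<lambda>xs. f (as @ xs @ cs))"
  unfolding coordinatewise_poly_def
proof (intro allI impI)
  fix xs :: "complex list" and l assume xs: "length xs = length Bs" and l: "l < length Bs"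
  have "length (as @ xs @ cs) = length (As @ Bs @ Cs)" "length As + l < length (As @ Bs @ Cs)"
    using len xs l by auto
  then obtain p where "degree p < length ((As @ Bs @ Cs) ! (length As + l))"
      "\<forall>t. f ((as @ xs @ cs)[length As + l := t]) = poly p t"
    using f unfolding coordinatewise_poly_def by blast
  then show "\<exists>p. degree p < length (Bs ! l) \<and> (\<forall>t. f (as @ xs[l := t] @ cs) = poly p t)"
    using len xs l by (auto simp: list_update_append nth_append intro!: exI[of _ p])
qed

definition tensor_weight :: "complex list list \<Rightarrow> complex list \<Rightarrow> complex" where
  "tensor_weight Ls ys = prod_list (map2 bary_weight Ls ys)"

lemma tensor_weight_Nil [simp]: "tensor_weight [] [] = 1"
  by (simp add: tensor_weight_def)

lemma tensor_weight_Cons [simp]: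
  "tensor_weight (L # Ls) (y # ys) = bary_weight L y * tensor_weight Ls ys"
  by (simp add: tensor_weight_def)

lemma tensor_weight_append:
  "length As = length as \<Longrightarrow>
    tensor_weight (As @ Bs) (as @ bs) = tensor_weight As as * tensor_weight Bs bs"
  by (simp add: tensor_weight_def)

lemma tensor_weight_nonzero: "tensor_weight Ls ys \<noteq> 0"
  by (auto simp: tensor_weight_def prod_list_zero_iff bary_weight_nonzero)

lemma sum_list_concat_map:
  "sum_list (concat (map f xs)) = (\<Sum>x\<leftarrow>xs. sum_list (f x))"
  by (induction xs) auto

text \<open>Induction over the variables: for a fixed first node \<open>a\<close>, the induction
  hypothesis for the slice at \<open>a\<close> evaluates the inner sum, and the one-variable formula
  then evaluates the sum over \<open>a\<close>.\<close>

lemma tensor_lagrange_barycentric: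
  assumes "list_all2 (\<lambda>x L. x \<notin> set L) xs Ls" and "\<forall>L\<in>set Ls. distinct L"
    and "coordinatewise_poly Ls f"
  shows "(\<Sum>ys\<leftarrow>product_lists Ls. tensor_weight Ls ys * f ys / prod_list (map2 (-) xs ys)) =
    f xs / prod_list (map2 (\<lambda>x L. \<Prod>a\<leftarrow>L. x - a) xs Ls)"
  using assms
proof (induction arbitrary: f rule: list_all2_induct)
  case Nil
  then show ?case by simp
next
  case (Cons x xs L Ls)
  let ?P = "prod_list (map2 (\<lambda>x L. \<Prod>a\<leftarrow>L. x - a) xs Ls)"
  have len: "length xs = length Ls" using Cons.hyps(2) by (rule list_all2_lengthD)
  have IH: "(\<Sum>ys\<leftarrow>product_lists Ls. tensor_weight Ls ys * f (a # ys) / prod_list (map2 (-) xs ys)) =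
      f (a # xs) / ?P" for a
    using Cons.prems coordinatewise_poly_freeze[of "[L]" Ls "[]" f "[a]" "[]"]
    by (intro Cons.IH) auto
  \<comment> \<open>The remaining coordinates are now fixed at the evaluation point, so one slice
    serves all nodes of the first variable.\<close>
  obtain p where p: "degree p < length L" "\<And>t. f (t # xs) = poly p t"
    using Cons.prems(2) len unfolding coordinatewise_poly_def
    by (metis length_Cons list_update_code(2) nth_Cons_0 zero_less_Suc)
  have "(\<Sum>ys\<leftarrow>product_lists (L # Ls).
        tensor_weight (L # Ls) ys * f ys / prod_list (map2 (-) (x # xs) ys)) =
      (\<Sum>a\<leftarrow>L. \<Sum>ys\<leftarrow>product_lists Ls. bary_weight L a / (x - a) *
        (tensor_weight Ls ys * f (a # ys) / prod_list (map2 (-) xs ys)))"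
    by (simp add: map_concat sum_list_concat_map o_def mult.assoc)
  also have "\<dots> = (\<Sum>a\<leftarrow>L. bary_weight L a / (x - a) * (f (a # xs) / ?P))"
    by (simp only: sum_list_const_mult IH)
  also have "\<dots> = (\<Sum>a\<leftarrow>L. bary_weight L a * poly p a / (x - a) * (1 / ?P))"
    by (simp add: p)
  also have "\<dots> = poly p x / (\<Prod>a\<leftarrow>L. x - a) * (1 / ?P)"
    unfolding sum_list_mult_const using Cons.prems(1) Cons.hyps(1) p
    by (subst lagrange_barycentric) auto
  finally show ?case by (simp add: p)
qed

section \<open>One-variable slices of multivariate polynomials\<close>

lemma poly_eval_update:
  assumes vars: "poly_vars P \<subseteq> {..<length xs}"
  obtains p where "degree p \<le> poly_deg_in P l" "\<And>t. poly_eval P (xs[l := t]) = poly p t"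
proof
  let ?c = "\<lambda>m. Poly_Mapping.lookup P m * (\<Prod>i\<in>Poly_Mapping.keys m - {l}. (xs ! i) ^ Poly_Mapping.lookup m i)"
  let ?p = "\<Sum>m\<in>Poly_Mapping.keys P. monom (?c m) (Poly_Mapping.lookup m l)"
  have "degree (monom (?c m) (Poly_Mapping.lookup m l)) \<le> poly_deg_in P l" if "m \<in> Poly_Mapping.keys P" for m
  proof -
    have "Poly_Mapping.lookup m l \<le> poly_deg_in P l" unfolding poly_deg_in_def using that by (intro Max_ge) auto
    then show ?thesis using degree_monom_le le_trans by blast
  qed
  then show "degree ?p \<le> poly_deg_in P l" by (intro degree_sum_le) auto
  show "poly_eval P (xs[l := t]) = poly ?p t" for t
    unfolding poly_eval_def poly_sum
  proof (rule sum.cong[OF refl])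
    fix m assume m: "m \<in> Poly_Mapping.keys P"
    have "(\<Prod>i\<in>Poly_Mapping.keys m. (xs[l := t] ! i) ^ Poly_Mapping.lookup m i) =
        t ^ Poly_Mapping.lookup m l * (\<Prod>i\<in>Poly_Mapping.keys m - {l}. (xs ! i) ^ Poly_Mapping.lookup m i)"
    proof (cases "l \<in> Poly_Mapping.keys m")
      case True
      \<comment> \<open>The update takes effect only at an existing position, which
        \<open>vars\<close> guarantees here.\<close>
      then have "l < length xs" using vars m by (auto simp: poly_vars_def)
      then show ?thesis using True by (subst prod.remove[of _ l]) (auto intro!: prod.cong)
    next
      \<comment> \<open>A monomial without the variable \<open>l\<close> has exponent 0 there, so
        its factor \<open>t ^ 0\<close> is 1.\<close>
      case False
      then have "xs[l := t] ! i = xs ! i" if "i \<in> Poly_Mapping.keys m" for i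
        using that by (metis nth_list_update_neq)
      then have "(\<Prod>i\<in>Poly_Mapping.keys m. (xs[l := t] ! i) ^ Poly_Mapping.lookup m i) =
          (\<Prod>i\<in>Poly_Mapping.keys m - {l}. (xs ! i) ^ Poly_Mapping.lookup m i)"
        using False by (intro prod.cong) auto
      then show ?thesis using False by (simp add: in_keys_iff)
    qed
    then show "Poly_Mapping.lookup P m * (\<Prod>i\<in>Poly_Mapping.keys m. (xs[l := t] ! i) ^ Poly_Mapping.lookup m i) =
        poly (monom (?c m) (Poly_Mapping.lookup m l)) t"
      by (simp add: poly_monom ac_simps)
  qed
qed

lemma poly_eval_coordinatewise_poly:
  assumes "poly_vars P \<subseteq> {..<length Ls}" "\<And>l. l < length Ls \<Longrightarrow> poly_deg_in P l < length (Ls ! l)"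
  shows "coordinatewise_poly Ls (poly_eval P)"
  unfolding coordinatewise_poly_def using assms poly_eval_update le_less_trans by metis

section \<open>Null vectors of Loewner matrices\<close>

text \<open>In the row of a point \<open>x\<close>, the factor \<open>g ys\<close> splits the sum
  into \<open>f x / g x\<close> times the interpolation sum of \<open>g\<close>, minus the
  interpolation sum of \<open>f\<close>. Both sums have the same denominator, so the two terms
  cancel.\<close>

lemma loewner_mat_kernel:
  assumes disj: "list_all2 (\<lambda>M L. set M \<inter> set L = {}) mu lam" and dist: "\<forall>L\<in>set lam. distinct L"
    and f: "coordinatewise_poly lam f" and g: "coordinatewise_poly lam g"
    and nz_lam: "\<And>ys. ys \<in> set (product_lists lam) \<Longrightarrow> g ys \<noteq> 0"
    and nz_mu: "\<And>xs. xs \<in> set (product_lists mu) \<Longrightarrow> g xs \<noteq> 0"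
  shows "vec_of_list (map (\<lambda>ys. tensor_weight lam ys * g ys) (product_lists lam))
    \<in> mat_kernel (loewner_mat (\<lambda>xs. f xs / g xs) mu lam)" (is "?v \<in> mat_kernel ?A")
proof (rule mat_kernelI)
  let ?X = "product_lists mu" and ?Y = "product_lists lam"
  show A: "?A \<in> carrier_mat (length ?X) (length ?Y)" by (simp add: loewner_mat_def)
  show v: "?v \<in> carrier_vec (length ?Y)" by (rule carrier_vecI) simp
  show "?A *\<^sub>v ?v = 0\<^sub>v (length ?X)"
  proof (rule eq_vecI)
    fix i assume "i < dim_vec (0\<^sub>v (length ?X) :: complex vec)"
    then have i: "i < length ?X" by simp
    let ?x = "?X ! i"
    let ?w = "tensor_weight lam" and ?d = "\<lambda>ys. prod_list (map2 (-) ?x ys)"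
    have x: "?x \<in> set ?X" using i by simp
    then have xm: "list_all2 (\<lambda>x M. x \<in> set M) ?x mu" by (simp add: product_lists_set)
    \<comment> \<open>The interpolation formula divides by differences to the nodes, so a row point
      must avoid the column points in every coordinate.\<close>
    have notin: "list_all2 (\<lambda>x L. x \<notin> set L) ?x lam"
      by (rule list_all2_trans[OF _ xm disj]) auto
    have entry: "?w ys * g ys * ((f ?x / g ?x - f ys / g ys) / ?d ys) =
        f ?x / g ?x * (?w ys * g ys / ?d ys) - ?w ys * f ys / ?d ys" if "ys \<in> set ?Y" for ys
      using nz_lam[OF that] by (simp add: right_diff_distrib diff_divide_distrib)
    have "(?A *\<^sub>v ?v) $ i = (\<Sum>j<length ?Y. ?A $$ (i, j) * ?v $ j)"
      using i A by (simp add: scalar_prod_def lessThan_atLeast0 loewner_mat_def)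
    also have "\<dots> = (\<Sum>j<length ?Y. (\<lambda>ys. ?w ys * g ys * ((f ?x / g ?x - f ys / g ys) / ?d ys)) (?Y ! j))"
      using i by (intro sum.cong) (simp_all add: loewner_mat_def vec_of_list_index Let_def)
    also have "\<dots> = (\<Sum>ys\<leftarrow>?Y. ?w ys * g ys * ((f ?x / g ?x - f ys / g ys) / ?d ys))"
      by (simp add: sum_list_sum_nth lessThan_atLeast0)
    also have "\<dots> = (\<Sum>ys\<leftarrow>?Y. f ?x / g ?x * (?w ys * g ys / ?d ys) - ?w ys * f ys / ?d ys)"
      using entry by (intro arg_cong[where f = sum_list] map_cong) auto
    also have "\<dots> = f ?x / g ?x * (\<Sum>ys\<leftarrow>?Y. ?w ys * g ys / ?d ys) - (\<Sum>ys\<leftarrow>?Y. ?w ys * f ys / ?d ys)"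
      by (simp only: sum_list_subtractf sum_list_const_mult)
    also have "\<dots> = 0"
      using nz_mu[OF x] by (simp add: tensor_lagrange_barycentric[OF notin dist f]
        tensor_lagrange_barycentric[OF notin dist g])
    finally show "(?A *\<^sub>v ?v) $ i = 0\<^sub>v (length ?X) $ i" using i by simp
  qed (use A in simp)
qed

section \<open>Entries of the stacked vectors\<close>

lemma product_lists_append:
  "product_lists (As @ Bs) =
    concat (map (\<lambda>p. map (\<lambda>q. p @ q) (product_lists Bs)) (product_lists As))"
proof (induction As)
  case (Cons A As)
  have "map (Cons x) (concat xss) = concat (map (map (Cons x)) xss)" for x and xss :: "'a list list list"
    by (simp add: map_concat)
  moreover have "concat (map f (concat xss)) = concat (map (\<lambda>xs. concat (map f xs)) xss)"
    for f :: "'a list \<Rightarrow> 'a list list" and xss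
    by (induction xss) auto
  moreover have "(@) (x # p) = (\<lambda>q. x # p @ q)" for x :: 'a and p
    by auto
  ultimately show ?case by (simp add: Cons o_def)
qed (simp add: map_idI)

lemma length_product_lists_prod: "length (product_lists Ls) = prod_list (map length Ls)"
  by (induction Ls) (auto simp: length_concat o_def sum_list_triv)

lemma nth_concat_uniform:
  assumes "\<forall>x\<in>set xs. length (f x) = m" "i < length xs * m"
  shows "concat (map f xs) ! i = f (xs ! (i div m)) ! (i mod m)"
  using assms
proof (induction xs arbitrary: i)
  case (Cons x xs)
  show ?case
  proof (cases "i < m")
    case False
    then have "0 < m" using Cons.prems by (cases m) auto
    then show ?thesis
      using Cons False by (simp add: nth_append le_div_geq le_mod_geq not_less)
  qed (use Cons.prems in \<open>simp add: nth_append\<close>)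
qed simp

text \<open>Quotient and remainder are the indices that occur in \<open>kronecker_vec\<close>, so
  the lexicographic order of the points matches the Kronecker product.\<close>

lemma nth_product_lists_append:
  assumes "i < length (product_lists (As @ Bs))"
  defines "m \<equiv> length (product_lists Bs)"
  shows "product_lists (As @ Bs) ! i =
    product_lists As ! (i div m) @ product_lists Bs ! (i mod m)"
proof -
  have i: "i < length (product_lists As) * m"
    using assms by (simp add: length_product_lists_prod)
  then have "i mod m < m" by (metis less_nat_zero_code mod_less_divisor mult_0_right neq0_conv)
  then show ?thesis
    using i unfolding product_lists_append by (subst nth_concat_uniform[where m = m]) (auto simp: m_def)
qed

text \<open>Extending every prefix by each node of variable \<open>l\<close> in turn runs through
  the points of the first \<open>l + 1\<close> variables in lexicographic order, which is the order
  of the stacked blocks.\<close>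

lemma bary_coeffs_eq:
  assumes "l < length lam"
    and "\<And>pre. pre \<in> set (product_lists (take l lam)) \<Longrightarrow>
      list_of_vec (normalized_null_vec (frozen_loewner_1d H mu lam pre)) = map (\<lambda>a. F (pre @ [a])) (lam ! l)"
  shows "bary_coeffs H mu lam l = vec_of_list (map F (product_lists (take (Suc l) lam)))"
proof -
  have "product_lists (take (Suc l) lam) =
      concat (map (\<lambda>p. map (\<lambda>a. p @ [a]) (lam ! l)) (product_lists (take l lam)))"
    using assms(1) by (simp add: take_Suc_conv_app_nth product_lists_append o_def map_concat)
  then show ?thesis
    unfolding bary_coeffs_def using assms(2)
    by (intro arg_cong[where f = vec_of_list])
       (auto simp: map_concat o_def intro!: arg_cong[where f = concat])
qed

section \<open>Entries of the decoupled product\<close>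

lemma dim_foldl_hadamard [simp]: "dim_vec (foldl (\<odot>) u vs) = dim_vec u"
  by (induction vs arbitrary: u) (simp_all add: hadamard_vec_def)

lemma index_foldl_hadamard:
  "i < dim_vec u \<Longrightarrow> foldl (\<odot>) u vs $ i = u $ i * (\<Prod>v\<leftarrow>vs. v $ i)"
  by (induction vs arbitrary: u) (simp_all add: hadamard_vec_def)

text \<open>A Kronecker product with an all-ones vector repeats each entry once per choice of the
  later coordinates. At the position of \<open>ys\<close>, the factor for variable \<open>l\<close>
  is therefore its entry at the prefix of \<open>ys\<close> of length \<open>l + 1\<close>.\<close>

lemma decoupled_coeffs_eq:
  assumes nonempty: "lam \<noteq> []"
    and F: "\<And>l. l < length lam \<Longrightarrow>
      bary_coeffs H mu lam l = vec_of_list (map (F l) (product_lists (take (Suc l) lam)))"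
  shows "decoupled_coeffs H mu lam =
    vec_of_list (map (\<lambda>ys. \<Prod>l<length lam. F l (take (Suc l) ys)) (product_lists lam))"
proof (rule eq_vecI)
  let ?n = "length lam" and ?Y = "product_lists lam"
  let ?b = "bary_coeffs H mu lam"
  let ?k = "\<lambda>l. kronecker_vec (?b l) (ones_vec (prod_list (map length (drop (Suc l) lam))))"
  \<comment> \<open>The index of the last variable, whose vector already has full length and starts
    the fold.\<close>
  obtain n' where n': "?n = Suc n'" using nonempty by (cases lam) auto
  have last: "?b n' = vec_of_list (map (F n') ?Y)" using F[of n'] n' by simp
  have dc: "decoupled_coeffs H mu lam = foldl (\<odot>) (?b n') (map ?k (rev [0..<n']))"
    by (simp add: decoupled_coeffs_def n')
  show dim: "dim_vec (decoupled_coeffs H mu lam) =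
      dim_vec (vec_of_list (map (\<lambda>ys. \<Prod>l<?n. F l (take (Suc l) ys)) ?Y))"
    by (simp add: dc last)
  fix i assume "i < dim_vec (vec_of_list (map (\<lambda>ys. \<Prod>l<?n. F l (take (Suc l) ys)) ?Y))"
  then have i: "i < length ?Y" by simp
  have len: "length (?Y ! i) = ?n" using i by (simp add: in_set_product_lists_length)
  have k: "?k l $ i = F l (take (Suc l) (?Y ! i))" if l: "l < ?n" for l
  proof -
    let ?As = "take (Suc l) lam" and ?Bs = "drop (Suc l) lam"
    let ?m = "prod_list (map length ?Bs)"
    have m: "?m = length (product_lists ?Bs)" by (simp add: length_product_lists_prod)
    have i': "i < length (product_lists ?As) * ?m"
      using i by (metis append_take_drop_id length_product_lists_prod map_append prod_list.append)
    then have mpos: "0 < ?m" by (metis gr0I less_nat_zero_code mult_0_right)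
    have d: "i div ?m < length (product_lists ?As)" by (rule less_mult_imp_div_less[OF i'])
    have "?Y ! i = product_lists ?As ! (i div ?m) @ product_lists ?Bs ! (i mod ?m)"
      using nth_product_lists_append[of i ?As ?Bs] i by (simp add: m)
    moreover have "length (product_lists ?As ! (i div ?m)) = Suc l"
      using d l in_set_product_lists_length[of "product_lists ?As ! (i div ?m)" ?As] by simp
    ultimately have "take (Suc l) (?Y ! i) = product_lists ?As ! (i div ?m)" by simp
    then show ?thesis
      using i' d mpos F[OF l] by (simp add: kronecker_vec_def ones_vec_def vec_of_list_index)
  qed
  \<comment> \<open>The fold visits the other variables in descending order; as they are distinct,
    their factors form a product over a set.\<close>
  have "decoupled_coeffs H mu lam $ i = F n' (?Y ! i) * (\<Prod>l<n'. ?k l $ i)"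
    using i prod.distinct_set_conv_list[of "rev [0..<n']" "\<lambda>l. ?k l $ i"]
    by (simp add: dc index_foldl_hadamard last vec_of_list_index o_def lessThan_atLeast0)
  also have "(\<Prod>l<n'. ?k l $ i) = (\<Prod>l<n'. F l (take (Suc l) (?Y ! i)))"
    using n' by (intro prod.cong) (auto intro: k)
  also have "F n' (?Y ! i) * \<dots> = (\<Prod>l<?n. F l (take (Suc l) (?Y ! i)))"
    using len by (simp add: n')
  finally show "decoupled_coeffs H mu lam $ i =
      vec_of_list (map (\<lambda>ys. \<Prod>l<?n. F l (take (Suc l) ys)) ?Y) $ i"
    using i by (simp add: vec_of_list_index)
qed

section \<open>The decoupled vector as a spanning null vector\<close>

theorem theorem5p4:
  fixes n :: nat and N D :: cpoly and H :: "complex list \<Rightarrow> complex"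
    and lam mu :: "complex list list"
  assumes n: "2 \<le> n"
    and vars: "poly_vars N \<subseteq> {..<n}" "poly_vars D \<subseteq> {..<n}"
    and rational: "D \<noteq> 0" "lowest_terms N D" "H = rat_eval N D"
    and lengths: "length lam = n" "length mu = n"
    and distinct_points: "\<forall>l<n. distinct (lam ! l @ mu ! l)"
    and denominator: "\<forall>xs. length xs = n \<and> (\<forall>l<n. xs ! l \<in> set (lam ! l) \<union> set (mu ! l))
                        \<longrightarrow> poly_eval D xs \<noteq> 0"
    and number_of_points: "\<forall>l<n. length (lam ! l) = rat_deg_in N D l + 1"
    and null_dim: "kernel_dim (loewner_mat H mu lam) = 1"
    and null_dim_frozen: "\<forall>l<n. \<forall>pre\<in>set (product_lists (take l lam)).
                            kernel_dim (frozen_loewner H mu lam pre) = 1"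
    and null_dim_frozen_1d: "\<forall>l<n. \<forall>pre\<in>set (product_lists (take l lam)).
                               kernel_dim (frozen_loewner_1d H mu lam pre) = 1"
  shows "spans_null_space (loewner_mat H mu lam) (decoupled_coeffs H mu lam)"
proof -
  let ?f = "poly_eval N" and ?g = "poly_eval D"
  let ?E = "\<lambda>ys. tensor_weight lam ys * ?g ys"
  let ?P = "map last lam"
  \<comment> \<open>For \<open>q\<close> of length \<open>l + 1\<close>, both points agree with
    \<open>q\<close> before coordinate \<open>l\<close> and with the last column points
    \<open>?P\<close> after it. At coordinate \<open>l\<close> the denominator has the last column
    point, which encodes the normalization.\<close>
  define F where "F l q = ?E (q @ drop (Suc l) ?P) / ?E (butlast q @ drop l ?P)" for l q
  have H: "H = (\<lambda>xs. ?f xs / ?g xs)" using rational(3) by (auto simp: rat_eval_def)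
  have dist: "distinct (lam ! l)" "set (mu ! l) \<inter> set (lam ! l) = {}" if "l < n" for l
    using distinct_points that by auto
  have nonempty: "lam ! l \<noteq> []" if "l < n" for l using number_of_points that by auto
  \<comment> \<open>\<open>rat_deg_in\<close> bounds the degrees of both \<open>N\<close> and
    \<open>D\<close>, so one node more than this degree suffices to interpolate either of
    them.\<close>
  have fg: "coordinatewise_poly lam ?f" "coordinatewise_poly lam ?g"
    using vars number_of_points lengths
    by (auto intro!: poly_eval_coordinatewise_poly simp: rat_deg_in_def)
  have nz: "?g xs \<noteq> 0"
    if "length xs = n" "\<And>l. l < n \<Longrightarrow> xs ! l \<in> set (lam ! l) \<union> set (mu ! l)" for xs
    using denominator that by blast
  \<comment> \<open>A frozen 1-D matrix evaluates \<open>H\<close> at points that mix a row point of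
    one variable with column points of the others.\<close>
  have nz_mixed: "?g (pre @ x # drop (Suc l) ?P) \<noteq> 0"
    if l: "l < n" and pre: "pre \<in> set (product_lists (take l lam))"
      and x: "x \<in> set (lam ! l) \<union> set (mu ! l)" for l pre x
  proof (rule nz)
    have pre': "length pre = l" "\<And>i. i < l \<Longrightarrow> pre ! i \<in> set (lam ! i)"
      using pre l lengths by (auto simp: product_lists_set list_all2_conv_all_nth)
    show "length (pre @ x # drop (Suc l) ?P) = n" using pre' l lengths by simp
    show "(pre @ x # drop (Suc l) ?P) ! i \<in> set (lam ! i) \<union> set (mu ! i)" if "i < n" for i
    proof (cases i l rule: linorder_cases)
      case less
      then show ?thesis using pre' by (simp add: nth_append)
    next
      case equal
      then show ?thesis using pre'(1) x by (simp add: nth_append)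
    next
      case greater
      then obtain k where k: "i = l + Suc k" by (metis less_imp_Suc_add add_Suc_right)
      then have "(pre @ x # drop (Suc l) ?P) ! i = ?P ! i"
        using pre'(1) that lengths by (simp only: nth_append_length_plus[of pre, unfolded pre'(1)]) simp
      then show ?thesis using nonempty[OF that] that lengths by simp
    qed
  qed
  have split: "drop l ?P = last (lam ! l) # drop (Suc l) ?P" if "l < n" for l
    using that lengths by (metis Cons_nth_drop_Suc length_map nth_map)
  have one_var: "list_of_vec (normalized_null_vec (frozen_loewner_1d H mu lam pre)) =
      map (\<lambda>a. F l (pre @ [a])) (lam ! l)"
    if l: "l < n" and pre: "pre \<in> set (product_lists (take l lam))" for l pre
  proof -
    let ?L = "lam ! l" and ?post = "drop (Suc l) ?P"
    let ?A = "frozen_loewner_1d H mu lam pre"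
    define w where "w a = bary_weight ?L a * ?g (pre @ a # ?post)" for a
    let ?v = "vec_of_list (map w ?L)"
    have len: "length pre = l"
      using pre l lengths by (simp add: in_set_product_lists_length)
    have lam: "take l lam @ ?L # drop (Suc l) lam = lam"
      using l lengths by (intro id_take_nth_drop[symmetric]) simp
    have A: "?A = loewner_mat (\<lambda>xs. ?f (pre @ xs @ ?post) / ?g (pre @ xs @ ?post)) [mu ! l] [?L]"
      by (simp add: frozen_loewner_1d_def len H drop_map)
    have "coordinatewise_poly [?L] (\<lambda>xs. h (pre @ xs @ ?post))"
      if "coordinatewise_poly lam h" for h
      using coordinatewise_poly_freeze[of "take l lam" "[?L]" "drop (Suc l) lam" h pre ?post]
        that len l lengths by (simp add: lam)
    then have "vec_of_list (map (\<lambda>ys. tensor_weight [?L] ys * ?g (pre @ ys @ ?post)) (product_lists [?L]))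
        \<in> mat_kernel ?A"
      unfolding A using dist[OF l] fg nz_mixed[OF l pre] by (intro loewner_mat_kernel) auto
    moreover have "map (\<lambda>ys. tensor_weight [?L] ys * ?g (pre @ ys @ ?post)) (product_lists [?L]) = map w ?L"
      by (simp add: map_concat o_def w_def)
    ultimately have ker: "?v \<in> mat_kernel ?A" by (simp only:)
    have vl: "?v $ (dim_vec ?v - 1) = w (last ?L)"
      using nonempty[OF l] by (simp add: vec_of_list_index last_conv_nth)
    have "w (last ?L) \<noteq> 0"
      using nz_mixed[OF l pre] nonempty[OF l] by (simp add: w_def bary_weight_nonzero)
    then have "normalized_null_vec ?A = (1 / w (last ?L)) \<cdot>\<^sub>v ?v"
      using normalized_null_vec_eq[OF _ ker] null_dim_frozen_1d l pre nonempty[OF l] vl by simp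
    then have "list_of_vec (normalized_null_vec ?A) = map (\<lambda>a. w a / w (last ?L)) ?L"
      by (intro nth_equalityI) (auto simp: list_of_vec_index vec_of_list_index)
    moreover have "F l (pre @ [a]) = w a / w (last ?L)" for a
    proof -
      have "?E (pre @ b # ?post) =
          tensor_weight (take l lam) pre * tensor_weight (drop (Suc l) lam) ?post * w b" for b
        using l lengths len tensor_weight_append[of "take l lam" pre "[?L] @ drop (Suc l) lam" "[b] @ ?post"]
        by (simp add: lam w_def)
      then show ?thesis
        by (simp add: F_def split[OF l] tensor_weight_nonzero)
    qed
    ultimately show ?thesis by simp
  qed
  let ?v = "vec_of_list (map ?E (product_lists lam))"
  have grid: "?E (take l ys @ drop l ?P) \<noteq> 0" if "ys \<in> set (product_lists lam)" for l ys
  proof -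
    have "length ys = n" "\<And>i. i < n \<Longrightarrow> ys ! i \<in> set (lam ! i)"
      using that lengths by (auto simp: product_lists_set list_all2_conv_all_nth)
    then have "?g (take l ys @ drop l ?P) \<noteq> 0"
      using lengths nonempty by (intro nz) (auto simp: nth_append min_def)
    then show ?thesis by (simp add: tensor_weight_nonzero)
  qed
  have "decoupled_coeffs H mu lam =
      vec_of_list (map (\<lambda>ys. \<Prod>l<length lam. F l (take (Suc l) ys)) (product_lists lam))"
    using n lengths one_var by (intro decoupled_coeffs_eq bary_coeffs_eq) auto
  also have "map (\<lambda>ys. \<Prod>l<length lam. F l (take (Suc l) ys)) (product_lists lam) =
      map (\<lambda>ys. ?E ys / ?E ?P) (product_lists lam)"
  proof (rule map_cong[OF refl])
    fix ys assume ys: "ys \<in> set (product_lists lam)"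
    \<comment> \<open>The values of \<open>?E\<close> along a path of grid points that replaces the
      coordinates of \<open>?P\<close> one by one by those of \<open>ys\<close>, from
      \<open>?P\<close> at \<open>l = 0\<close> to \<open>ys\<close> at
      \<open>l = n\<close>.\<close>
    let ?z = "\<lambda>l. ?E (take l ys @ drop l ?P)"
    have len: "length ys = n" using ys lengths by (simp add: in_set_product_lists_length)
    have "F l (take (Suc l) ys) = ?z (Suc l) / ?z l" if "l < n" for l
      using that len by (simp add: F_def butlast_take)
    then have "(\<Prod>l<length lam. F l (take (Suc l) ys)) = (\<Prod>l<n. ?z (Suc l) / ?z l)"
      using lengths by (intro prod.cong) auto
    also have "\<dots> = ?z n / ?z 0"
      using grid[OF ys] by (rule prod_lessThan_telescope)
    finally show "(\<Prod>l<length lam. F l (take (Suc l) ys)) = ?E ys / ?E ?P"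
      using len lengths by simp
  qed
  also have "vec_of_list \<dots> = (1 / ?E ?P) \<cdot>\<^sub>v ?v"
    by (intro eq_vecI) (auto simp: vec_of_list_index)
  finally have c: "decoupled_coeffs H mu lam = (1 / ?E ?P) \<cdot>\<^sub>v ?v" .
  have A: "loewner_mat H mu lam \<in> carrier_mat (length (product_lists mu)) (length (product_lists lam))"
    by (simp add: loewner_mat_def)
  have "?v \<in> mat_kernel (loewner_mat H mu lam)"
    unfolding H
  proof (rule loewner_mat_kernel)
    show "list_all2 (\<lambda>M L. set M \<inter> set L = {}) mu lam"
      using dist lengths by (simp add: list_all2_conv_all_nth)
    show "\<forall>L\<in>set lam. distinct L" using dist lengths by (metis in_set_conv_nth)
    show "?g ys \<noteq> 0" if "ys \<in> set (product_lists lam)" for ys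
      using that lengths by (intro nz) (auto simp: product_lists_set list_all2_conv_all_nth)
    show "?g xs \<noteq> 0" if "xs \<in> set (product_lists mu)" for xs
      using that lengths by (intro nz) (auto simp: product_lists_set list_all2_conv_all_nth)
  qed (rule fg)+
  then have ker: "decoupled_coeffs H mu lam \<in> mat_kernel (loewner_mat H mu lam)"
    unfolding c by (rule mat_kernel_smult[OF A])
  \<comment> \<open>The entry at the grid point \<open>?P\<close> is a quotient of equal nonzero
    values, hence 1, so the vector is not zero.\<close>
  have last: "?P \<in> set (product_lists lam)"
    using lengths nonempty by (simp add: product_lists_set list_all2_conv_all_nth)
  then obtain i where i: "i < length (product_lists lam)" "product_lists lam ! i = ?P"
    by (auto simp: in_set_conv_nth)
  then have "decoupled_coeffs H mu lam $ i = 1"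
    using grid[OF last, of 0] by (simp add: c vec_of_list_index)
  then have "decoupled_coeffs H mu lam \<noteq> 0\<^sub>v (dim_col (loewner_mat H mu lam))"
    using i A by auto
  then show ?thesis by (rule spans_null_spaceI[OF null_dim ker])
qed

end
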